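(* Let $k\ge1$ and let $G$ be a $k$-tree with maximum degree $\Delta$. Then $G$ has a rooted tree-partition $(T,\{T_x:x\in V(T)\})$ such that for all nodes $x$ of $T$: (a) if $x$ is a non-root node of $T$ and $y$ is the parent node of $x$, then the set of vertices in $T_y$ with a neighbour in $T_x$ forms a clique $C_x$ of $G$; and (b) the induced subgraph $G[T_x]$ is a connected $(k-1)$-tree. Furthermore the width of $(T,\{T_x:x\in V(T)\})$ is at most $\max\{1,k(\Delta-1)\}$.
   Context: A $k$-tree is defined recursively: the empty graph is a $k$-tree, and the graph obtained from a $k$-tree by adding a new vertex adjacent to every vertex of a clique with at most $k$ vertices is a $k$-tree. A tree-partition of a graph $G$ is a tree $T$ together with pairwise disjoint sets (bags) $T_x\subseteq V(G)$, $x\in V(T)$, whose union is $V(G)$, such that for every edge $vw$ of $G$ either $v,w\in T_x$ for some node $x$, or $v\in T_x$, $w\in T_y$ for some edge $xy$ of $T$. It is rooted if $T$ is rooted at some node. Its width is the maximum cardinality of a bag. *)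

theory Defs
  imports
    "Graph_Theory.Pair_Digraph"
    "Graph_Theory.Digraph_Component"
    "HOL-Library.Disjoint_Sets"
begin

text \<open>
  Finite simple graphs are rendered as in \<^theory>\<open>Graph_Theory.Pair_Digraph\<close>: a finite vertex
  set with a symmetric, irreflexive arc relation (locale \<^locale>\<open>pair_graph\<close>). The undirected edge
  \<open>vw\<close> is represented by the two arcs \<open>(v, w)\<close> and \<open>(w, v)\<close>.
\<close>

definition clique :: "'a pair_pre_digraph \<Rightarrow> 'a set \<Rightarrow> bool" where
  "clique G C \<longleftrightarrow> C \<subseteq> pverts G \<and> (\<forall>u\<in>C. \<forall>v\<in>C. u \<noteq> v \<longrightarrow> (u, v) \<in> parcs G)"

text \<open>The clique may be empty or have fewer than \<open>k\<close> vertices, so k-trees need not be connected.\<close>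

inductive k_tree :: "nat \<Rightarrow> 'a pair_pre_digraph \<Rightarrow> bool" for k :: nat where
  empty: "k_tree k \<lparr>pverts = {}, parcs = {}\<rparr>"
| add_vertex:
    "\<lbrakk>k_tree k G; v \<notin> pverts G; clique G C; card C \<le> k\<rbrakk>
      \<Longrightarrow> k_tree k \<lparr>pverts = insert v (pverts G), parcs = parcs G \<union> {v} \<times> C \<union> C \<times> {v}\<rparr>"

lemma k_tree_imp_pair_graph: "k_tree k G \<Longrightarrow> pair_graph G"
proof (induction rule: k_tree.induct)
  case empty
  show ?case by unfold_locales (auto simp: symmetric_def sym_def)
next
  case (add_vertex G v C)
  interpret pair_graph G by (rule add_vertex.IH)
  have "finite C" using add_vertex.hyps finite_subset[OF _ pair_finite_verts] by (auto simp: clique_def)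
  then show ?case
    using add_vertex.hyps arcs_symmetric no_loops' pair_finite_verts pair_finite_arcs
    by unfold_locales
      (auto simp: clique_def symmetric_def sym_def dest: wellformed')
qed

text \<open>In a symmetric graph without parallel arcs the out-degree counts the neighbours.
  The maximum degree of the empty graph is taken to be 0.\<close>

definition max_degree :: "'a pair_pre_digraph \<Rightarrow> nat" where
  "max_degree G = Max (insert 0 (out_degree (with_proj G) ` pverts G))"

definition pair_induced :: "'a pair_pre_digraph \<Rightarrow> 'a set \<Rightarrow> 'a pair_pre_digraph" where
  "pair_induced G S = \<lparr>pverts = S, parcs = parcs G \<inter> S \<times> S\<rparr>"

lemma with_proj_pair_induced: "with_proj (pair_induced G S) = with_proj G \<restriction> S"
  by (auto simp: with_proj_def pair_induced_def induce_subgraph_def)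

text \<open>The constant \<^const>\<open>connected\<close> requires a vertex. Here the graph without vertices counts as
  connected; this matters because bags of tree-partitions may be empty.\<close>

definition graph_connected :: "'a pair_pre_digraph \<Rightarrow> bool" where
  "graph_connected G \<longleftrightarrow> pverts G = {} \<or> connected (with_proj G)"

text \<open>The library's \<^const>\<open>tree\<close> is about directed cycles and is unsuitable for symmetric graphs,
  where each edge gives the directed cycle \<open>(u, v), (v, u)\<close>. The cycles of a simple undirected graph
  are the directed cycles of length at least 3. Note that \<^const>\<open>connected\<close> makes a tree nonempty.\<close>

definition undirected_tree :: "'a pair_pre_digraph \<Rightarrow> bool" where
  "undirected_tree T \<longleftrightarrow> pair_graph T \<and> connected (with_proj T) \<and>
     \<not> (\<exists>p. pre_digraph.cycle (with_proj T) p \<and> length p \<ge> 3)"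

text \<open>\<open>y\<close> is the parent of \<open>x\<close> if it is the penultimate node of the path from the root \<open>r\<close> to \<open>x\<close>.
  The root itself has no parent, since the nodes of an \<open>apath\<close> are distinct.\<close>

definition is_parent :: "'a pair_pre_digraph \<Rightarrow> 'a \<Rightarrow> 'a \<Rightarrow> 'a \<Rightarrow> bool" where
  "is_parent T r y x \<longleftrightarrow> (\<exists>p. pre_digraph.apath (with_proj T) r (p @ [(y, x)]) x)"

definition tree_partition ::
  "'a pair_pre_digraph \<Rightarrow> 'b pair_pre_digraph \<Rightarrow> ('b \<Rightarrow> 'a set) \<Rightarrow> bool" where
  "tree_partition G T B \<longleftrightarrow>
     undirected_tree T \<and>
     disjoint_family_on B (pverts T) \<and>
     (\<Union>x\<in>pverts T. B x) = pverts G \<and>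
     (\<forall>(v, w)\<in>parcs G.
        (\<exists>x\<in>pverts T. v \<in> B x \<and> w \<in> B x) \<or>
        (\<exists>(x, y)\<in>parcs T. v \<in> B x \<and> w \<in> B y))"

definition rooted_tree_partition ::
  "'a pair_pre_digraph \<Rightarrow> 'b pair_pre_digraph \<Rightarrow> 'b \<Rightarrow> ('b \<Rightarrow> 'a set) \<Rightarrow> bool" where
  "rooted_tree_partition G T r B \<longleftrightarrow> tree_partition G T B \<and> r \<in> pverts T"

definition tp_width :: "'b pair_pre_digraph \<Rightarrow> ('b \<Rightarrow> 'a set) \<Rightarrow> nat" where
  "tp_width T B = Max ((\<lambda>x. card (B x)) ` pverts T)"

end

theory Submission
  imports Defs
begin

text \<open>
  The tree-partition is built along the construction of the \<open>k\<close>-tree. A new vertex \<open>v\<close> is attached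
  to a clique \<open>C\<close>, which lies in one bag or in two bags \<open>x\<close> and \<open>par x\<close>. In the first case \<open>{v}\<close>
  becomes a new bag below the one containing \<open>C\<close>. In the second case \<open>v\<close> joins the lower bag \<open>x\<close>:
  there it is attached to at most \<open>k - 1\<close> vertices, and its neighbours in \<open>par x\<close> already have
  neighbours in \<open>x\<close>, since \<open>C\<close> is a clique meeting both bags.

  For the width, every vertex of \<open>x\<close> has a neighbour in the clique \<open>C\<^sub>x\<close>, which has at most \<open>k\<close>
  vertices because \<open>par x\<close> induces a \<open>(k - 1)\<close>-tree; each of them spends one of its \<open>\<Delta>\<close> edges
  on the bag above \<open>par x\<close>. If there is no vertex above \<open>par x\<close>, then \<open>par x\<close> is a single vertex
  and the bag \<open>x\<close> has at most \<open>\<Delta>\<close> vertices; this is at most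
  \<open>max {1, k(\<Delta> - 1)}\<close> if \<open>k \<ge> 2\<close>, while for \<open>k = 1\<close> all bags have at most one vertex.
\<close>

section \<open>Trees given by a parent function\<close>

lemma (in pair_sym_digraph) connected_iff_rtrancl:
  "connected (with_proj G) \<longleftrightarrow>
     pverts G \<noteq> {} \<and> (\<forall>u\<in>pverts G. \<forall>v\<in>pverts G. (u, v) \<in> (parcs G)\<^sup>*)"
proof -
  have "(u, v) \<in> rtrancl_on (pverts G) (parcs G)"
    if "(u, v) \<in> (parcs G)\<^sup>*" "u \<in> pverts G" "v \<in> pverts G" for u v
    using that by (rule rtrancl_consistent_rtrancl_on) (rule in_arcsD2)
  moreover have "(u, v) \<in> (parcs G)\<^sup>*"
    if "(u, v) \<in> rtrancl_on (pverts G) (parcs G)" for u v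
    using that by (rule rtrancl_on_rtranclI)
  moreover have "(\<lambda>(u, v). (v, u)) ` parcs G \<subseteq> parcs G"
    by clarsimp (rule arcs_symmetric)
  then have "(parcs G)\<^sup>s = parcs G"
    unfolding symcl_def by (rule Un_absorb2)
  ultimately show ?thesis
    by (simp add: connected_conv cong: ball_cong) blast
qed

definition parent_tree :: "nat \<Rightarrow> (nat \<Rightarrow> nat) \<Rightarrow> nat pair_pre_digraph" where
  "parent_tree n par = \<lparr>pverts = {..<n},
     parcs = (\<lambda>i. (i, par i)) ` {0<..<n} \<union> (\<lambda>i. (par i, i)) ` {0<..<n}\<rparr>"

text \<open>Nodes are numbered in their order of creation with root 0, so that a parent precedes its
  children. Connectedness and acyclicity then reduce to the order on the numbers.\<close>

locale parent_function =
  fixes n :: nat and par :: "nat \<Rightarrow> nat"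
  assumes n_pos: "0 < n"
    and par_less: "0 < i \<Longrightarrow> i < n \<Longrightarrow> par i < i"
begin

lemma pverts_parent_tree [simp]: "pverts (parent_tree n par) = {..<n}"
  by (simp add: parent_tree_def)

lemma in_parcs_parent_tree:
  "(x, y) \<in> parcs (parent_tree n par) \<longleftrightarrow>
     (0 < x \<and> x < n \<and> y = par x) \<or> (0 < y \<and> y < n \<and> x = par y)"
  by (auto simp: parent_tree_def)

lemma par_eq_if_less:
  assumes "(x, y) \<in> parcs (parent_tree n par)" "x \<le> y"
  shows "x = par y"
  using assms par_less[of x] by (auto simp: in_parcs_parent_tree)

lemma pair_graph_parent_tree: "pair_graph (parent_tree n par)"
proof
  show "finite (pverts (parent_tree n par))" "finite (parcs (parent_tree n par))"
    by (auto simp: parent_tree_def)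
  show "symmetric (with_proj (parent_tree n par))"
    by (auto simp: symmetric_def sym_def in_parcs_parent_tree)
  fix e assume e: "e \<in> parcs (parent_tree n par)"
  obtain x y where xy: "e = (x, y)" by fastforce
  show "fst e \<in> pverts (parent_tree n par)" "snd e \<in> pverts (parent_tree n par)" "fst e \<noteq> snd e"
    using e par_less[of x] par_less[of y] unfolding xy
    by (auto simp: in_parcs_parent_tree)
qed

sublocale tree: pair_graph "parent_tree n par"
  by (rule pair_graph_parent_tree)

lemma connected_parent_tree: "connected (with_proj (parent_tree n par))"
proof -
  have down: "(i, 0) \<in> (parcs (parent_tree n par))\<^sup>*" if "i < n" for i
    using that
  proof (induction i rule: less_induct)
    case (less i)
    show ?case
    proof (cases "i = 0")
      case False
      then have "(i, par i) \<in> parcs (parent_tree n par)" "par i < i"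
        using less.prems par_less by (auto simp: in_parcs_parent_tree)
      then show ?thesis using less by (meson converse_rtrancl_into_rtrancl order.strict_trans)
    qed simp
  qed
  have "sym ((parcs (parent_tree n par))\<^sup>*)"
    by (intro sym_rtrancl symI) (rule tree.arcs_symmetric)
  then show ?thesis
    unfolding tree.connected_iff_rtrancl using down n_pos
    by (auto dest: symD intro: rtrancl_trans)
qed

text \<open>Take the largest node \<open>m\<close> on the cycle. Its predecessor and its successor
  on the cycle are adjacent to \<open>m\<close> and not larger, so both equal \<open>par m\<close>.
  As the nodes of a cycle are distinct, the cycle has at most two arcs.\<close>

lemma no_long_cycle:
  assumes cyc: "tree.cycle p" and len: "3 \<le> length p"
  shows False
proof -
  from cyc obtain u where aw: "tree.awalk u p u" and dist: "distinct (tl (pawalk_verts u p))"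
    and "p \<noteq> []"
    unfolding tree.cycle_def by auto
  have cas: "pcas u p u" and arcs: "set p \<subseteq> parcs (parent_tree n par)"
    using aw by (auto simp: tree.awalk_def)
  have verts: "pawalk_verts u p = fst (hd p) # map snd p"
    using tree.awalk_verts_conv'[OF cas] \<open>p \<noteq> []\<close> by simp
  have dsnd: "distinct (map snd p)" using dist verts by simp
  have "snd (q ! i) = fst (q ! Suc i)" if "pcas w q v" "Suc i < length q" for w q i and v :: nat
    using that
  proof (induction q arbitrary: w i)
    case (Cons e q)
    then show ?case by (cases q; cases i) auto
  qed simp
  with cas have link: "snd (p ! i) = fst (p ! Suc i)" if "Suc i < length p" for i
    using that by blast
  have ends: "snd (last p) = fst (hd p)"
  proof -
    have "fst (hd p) = u" using cas \<open>p \<noteq> []\<close> by (cases p) auto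
    moreover have "snd (last q) = v" if "pcas w q v" "q \<noteq> []" for w q and v :: nat
      using that by (induction q arbitrary: w) (auto split: if_splits)
    ultimately show ?thesis using cas \<open>p \<noteq> []\<close> by simp
  qed
  define m where "m = Max (set (map snd p))"
  have "m \<in> set (map snd p)" unfolding m_def using \<open>p \<noteq> []\<close> by (intro Max_in) auto
  then obtain i where i: "i < length p" "snd (p ! i) = m" by (auto simp: in_set_conv_nth)
  have max: "snd (p ! j) \<le> m" if "j < length p" for j
    unfolding m_def using that by (intro Max_ge) auto
  \<comment> \<open>Indices are cyclic. Arc \<open>i\<close> enters \<open>m\<close> and arc
    \<open>i1\<close> leaves it; arc \<open>i0\<close> precedes arc \<open>i\<close>. The heads of
    arcs \<open>i0\<close> and \<open>i1\<close> are the two cycle neighbours of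
    \<open>m\<close>.\<close>
  define i1 where "i1 = (if Suc i < length p then Suc i else 0)"
  define i0 where "i0 = (if i = 0 then length p - 1 else i - 1)"
  have succ: "i1 < length p" "fst (p ! i1) = m"
  proof -
    have "i = length p - 1" if "\<not> Suc i < length p" using that i(1) by linarith
    then show "i1 < length p" "fst (p ! i1) = m"
      using i link[of i] ends \<open>p \<noteq> []\<close> by (auto simp: i1_def hd_conv_nth last_conv_nth)
  qed
  have pred: "i0 < length p" "fst (p ! i) = snd (p ! i0)"
    using i link[of "i - 1"] ends \<open>p \<noteq> []\<close>
    by (auto simp: i0_def hd_conv_nth last_conv_nth)
  have "(snd (p ! i0), m) \<in> parcs (parent_tree n par)"
    using arcs nth_mem[OF i(1)] i(2) pred(2) by (metis prod.collapse subsetD)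
  then have a: "snd (p ! i0) = par m"
    using max[OF pred(1)] by (rule par_eq_if_less)
  have "(m, snd (p ! i1)) \<in> parcs (parent_tree n par)"
    using arcs nth_mem[OF succ(1)] succ(2) by (metis prod.collapse subsetD)
  then have b: "snd (p ! i1) = par m"
    using max[OF succ(1)] by (rule par_eq_if_less[OF tree.arcs_symmetric])
  \<comment> \<open>The positions just before and just after \<open>i\<close> agree only in a cycle
    of length at most 2.\<close>
  have "i0 = i1" using a b nth_eq_iff_index_eq[OF dsnd, of i0 i1] pred(1) succ(1) by simp
  then show False using i(1) len by (auto simp: i0_def i1_def split: if_splits)
qed

lemma undirected_tree_parent_tree: "undirected_tree (parent_tree n par)"
  using pair_graph_parent_tree connected_parent_tree no_long_cycle
  by (auto simp: undirected_tree_def)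

text \<open>A path from the root goes down at every step: after a first step down, a step up would
  return to the node just left. The induction follows the path.\<close>

lemma is_parent_parent_tree:
  assumes "is_parent (parent_tree n par) 0 y x"
  shows "0 < x \<and> x < n \<and> y = par x"
proof -
  have "0 < x \<and> x < n \<and> y = par x" if "tree.apath 0 (p @ [(y, x)]) x" for p
    using that
  proof (induction p arbitrary: y x rule: rev_induct)
    case Nil
    then show ?case using par_less by (auto simp: tree.apath_simps in_parcs_parent_tree)
  next
    case (snoc e p)
    obtain a b where e: "e = (a, b)" by fastforce
    have ap: "tree.apath 0 (p @ [e]) y" and arc: "(y, x) \<in> parcs (parent_tree n par)"
      and x: "x \<notin> set (pawalk_verts 0 (p @ [e]))"
      using snoc.prems tree.apath_append_iff[of 0 "p @ [e]" "[(y, x)]" x]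
      by (auto simp: tree.apath_simps)
    have "b = y" using ap by (auto simp: e tree.apath_append_iff tree.apath_simps)
    then have "a = par y" using snoc.IH ap e by blast
    \<comment> \<open>The node \<open>par y\<close> is already on the path, so \<open>x\<close>
      differs from it and the arc from \<open>y\<close> to \<open>x\<close> can only lead to a
      child.\<close>
    moreover have "a \<in> set (pawalk_verts 0 (p @ [e]))"
      using tree.awalk_verts_arc1[of e "p @ [e]" 0] by (simp add: e)
    ultimately show ?case using arc x by (auto simp: in_parcs_parent_tree)
  qed
  then show ?thesis using assms by (auto simp: is_parent_def)
qed

end


section \<open>Attaching a vertex to a clique\<close>

abbreviation attach :: "'a pair_pre_digraph \<Rightarrow> 'a \<Rightarrow> 'a set \<Rightarrow> 'a pair_pre_digraph" where
  "attach G v C \<equiv> \<lparr>pverts = insert v (pverts G), parcs = parcs G \<union> {v} \<times> C \<union> C \<times> {v}\<rparr>"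

lemma pair_induced_attach_notin:
  assumes "v \<notin> S"
  shows "pair_induced (attach G v C) S = pair_induced G S"
  using assms by (auto simp: pair_induced_def)

text \<open>This brings the graph induced on an enlarged bag into the shape of the rule
  \<open>k_tree.add_vertex\<close>.\<close>

lemma (in pair_wf_digraph) pair_induced_attach_insert:
  assumes "v \<notin> pverts G" "C \<subseteq> pverts G"
  shows "pair_induced (attach G v C) (insert v S) = attach (pair_induced G S) v (C \<inter> S)"
  using assms by (auto simp: pair_induced_def dest: in_arcsD1 in_arcsD2)

lemma k_tree_empty_induced: "k_tree m (pair_induced G {})"
  using k_tree.empty by (simp add: pair_induced_def)

lemma graph_connected_empty_induced: "graph_connected (pair_induced G {})"
  by (simp add: pair_induced_def graph_connected_def)

text \<open>A neighbour in \<open>C\<close> links \<open>v\<close> to the rest. The alternative of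
  an empty \<open>H\<close> serves bags that start with a single vertex.\<close>

lemma graph_connected_attach:
  assumes "pair_graph H" "pair_graph (attach H v C)"
    and "graph_connected H" "C \<subseteq> pverts H" "C \<noteq> {} \<or> pverts H = {}"
  shows "graph_connected (attach H v C)"
proof (cases "pverts H = {}")
  case True
  interpret A: pair_graph "attach H v C" by fact
  show ?thesis using True unfolding graph_connected_def A.connected_iff_rtrancl by simp
next
  case False
  interpret H: pair_graph H by fact
  interpret A: pair_graph "attach H v C" by fact
  obtain c where c: "c \<in> C" using assms(5) False by auto
  have reach: "(x, y) \<in> (parcs (attach H v C))\<^sup>*" if "x \<in> pverts H" "y \<in> pverts H" for x y
  proof -
    have "(x, y) \<in> (parcs H)\<^sup>*"
      using assms(3) False that by (simp add: graph_connected_def H.connected_iff_rtrancl)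
    then show ?thesis by (rule rtrancl_mono[THEN subsetD, rotated]) auto
  qed
  have "(v, c) \<in> parcs (attach H v C)" "(c, v) \<in> parcs (attach H v C)" "c \<in> pverts H"
    using c assms(4) by auto
  then have "(x, v) \<in> (parcs (attach H v C))\<^sup>*" "(v, x) \<in> (parcs (attach H v C))\<^sup>*"
    if "x \<in> pverts H" for x
    using reach[OF that, of c] reach[OF _ that, of c]
    by (blast intro: rtrancl_into_rtrancl converse_rtrancl_into_rtrancl)+
  then show ?thesis
    using reach unfolding graph_connected_def A.connected_iff_rtrancl by auto
qed

lemma clique_subset: "clique G C \<Longrightarrow> D \<subseteq> C \<Longrightarrow> clique G D"
  by (auto simp: clique_def)

lemma clique_attach: "clique G C \<Longrightarrow> clique (attach G v D) C"
  by (auto simp: clique_def)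

lemma clique_pair_induced: "clique G C \<Longrightarrow> C \<subseteq> S \<Longrightarrow> clique (pair_induced G S) C"
  by (auto simp: clique_def pair_induced_def)

text \<open>If a clique contains the vertex \<open>v\<close> added last, its other vertices lie in
  \<open>C\<close>, which has at most \<open>m\<close> elements. Otherwise it is a clique of the
  smaller graph.\<close>

lemma k_tree_clique_card:
  assumes "k_tree m G" "clique G K"
  shows "card K \<le> Suc m"
  using assms
proof (induction arbitrary: K rule: k_tree.induct)
  case empty
  then show ?case by (simp add: clique_def)
next
  case (add_vertex G v C)
  interpret pair_graph G using add_vertex.hyps(1) by (rule k_tree_imp_pair_graph)
  have fin: "finite C"
    using add_vertex.hyps(3) pair_finite_verts by (auto simp: clique_def intro: finite_subset)
  show ?case
  proof (cases "v \<in> K")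
    case True
    then have "K - {v} \<subseteq> C"
      using add_vertex.prems add_vertex.hyps(2) by (auto simp: clique_def dest: wellformed')
    then have "card (K - {v}) \<le> m"
      using add_vertex.hyps(4) by (rule order_trans[OF card_mono[OF fin]])
    then show ?thesis using True by (simp add: card_Diff_singleton)
  next
    case False
    then have "clique G K" using add_vertex.prems by (auto simp: clique_def)
    then show ?thesis by (rule add_vertex.IH)
  qed
qed

section \<open>Bags\<close>

text \<open>Bags are the fibres of a map to the nodes: they are disjoint by construction, and a new
  vertex is placed by a function update.\<close>

definition bag :: "'a pair_pre_digraph \<Rightarrow> ('a \<Rightarrow> nat) \<Rightarrow> nat \<Rightarrow> 'a set" where
  "bag G b x = {v \<in> pverts G. b v = x}"

text \<open>The root \<open>0\<close> carries an empty bag, so that the components of \<open>G\<close> hang off it, each starting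
  with a one-vertex bag.\<close>

locale bag_assignment = parent_function n par for n par +
  fixes k :: nat and G :: "'a pair_pre_digraph" and b :: "'a \<Rightarrow> nat"
  assumes k_tree: "k_tree k G"
    and bag_range: "v \<in> pverts G \<Longrightarrow> 0 < b v \<and> b v < n"
    and bag_edge: "(v, w) \<in> parcs G \<Longrightarrow> b v = b w \<or> par (b v) = b w \<or> par (b w) = b v"
    and parent_clique: "0 < x \<Longrightarrow> x < n \<Longrightarrow>
      clique G {v \<in> bag G b (par x). \<exists>w\<in>bag G b x. (v, w) \<in> parcs G}"
    and bag_connected: "x < n \<Longrightarrow> graph_connected (pair_induced G (bag G b x))"
    and bag_k_tree: "x < n \<Longrightarrow> k_tree (k - 1) (pair_induced G (bag G b x))"
    and top_bag: "0 < x \<Longrightarrow> x < n \<Longrightarrow> par x = 0 \<Longrightarrow> card (bag G b x) \<le> 1"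
    and parent_neighbour: "0 < x \<Longrightarrow> x < n \<Longrightarrow> par x \<noteq> 0 \<Longrightarrow> w \<in> bag G b x \<Longrightarrow>
      \<exists>v\<in>bag G b (par x). (v, w) \<in> parcs G"
    and bag_singleton: "k = 1 \<Longrightarrow> x < n \<Longrightarrow> card (bag G b x) \<le> 1"
begin

sublocale graph: pair_graph G
  using k_tree by (rule k_tree_imp_pair_graph)

lemma bag_root [simp]: "bag G b 0 = {}"
  using bag_range by (auto simp: bag_def)

text \<open>Let \<open>x\<close> be the largest node whose bag meets \<open>C\<close>. Every other
  vertex of \<open>C\<close> is adjacent to one in \<open>x\<close>, hence lies in \<open>x\<close>,
  its parent or a child; children have larger numbers.\<close>

lemma clique_in_two_bags:
  assumes "clique G C" "C \<noteq> {}"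
  obtains x where "0 < x" "x < n" "C \<subseteq> bag G b x \<union> bag G b (par x)" "C \<inter> bag G b x \<noteq> {}"
proof -
  have fin: "finite C" and sub: "C \<subseteq> pverts G"
    using assms(1) graph.pair_finite_verts by (auto simp: clique_def intro: finite_subset)
  define x where "x = Max (b ` C)"
  have "x \<in> b ` C" unfolding x_def using fin assms(2) by (intro Max_in) auto
  then obtain u where u: "u \<in> C" "b u = x" by auto
  have "b w = x \<or> b w = par x" if w: "w \<in> C" for w
  proof (cases "w = u")
    case False
    then have "(u, w) \<in> parcs G" using assms(1) u(1) w by (simp add: clique_def)
    moreover have "b w \<le> x" unfolding x_def using fin w by (intro Max_ge) auto
    \<comment> \<open>This excludes that \<open>x\<close> is the parent of \<open>b w\<close>, the
      third case of \<open>bag_edge\<close>.\<close>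
    moreover have "par (b w) < b w" using w sub bag_range par_less by blast
    ultimately show ?thesis using bag_edge[of u w] u(2) by auto
  qed (use u in simp)
  then have "C \<subseteq> bag G b x \<union> bag G b (par x)" using sub by (auto simp: bag_def)
  moreover have "u \<in> C \<inter> bag G b x" using u sub by (auto simp: bag_def)
  moreover have "0 < x" "x < n" using u sub bag_range by auto
  ultimately show ?thesis using that by blast
qed

text \<open>The node \<open>n\<close> becomes a child of \<open>x\<close>. An empty \<open>C\<close>
  starts a new component and must hang off the root, since below any other node
  \<open>parent_neighbour\<close> asks for a neighbour of \<open>v\<close> in the bag of
  \<open>x\<close>.\<close>

lemma new_bag:
  assumes v: "v \<notin> pverts G" and C: "clique G C" "card C \<le> k"
    and x: "x < n" "C \<subseteq> bag G b x" "C = {} \<Longrightarrow> x = 0"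
  shows "bag_assignment (Suc n) (par(n := x)) k (attach G v C) (b(v := n))"
proof -
  let ?H = "attach G v C" and ?b = "b(v := n)"
  have kt: "k_tree k ?H" using k_tree v C by (rule k_tree.add_vertex)
  have CG: "C \<subseteq> pverts G" using C by (simp add: clique_def)
  have old: "bag ?H ?b y = bag G b y" if "y < n" for y
    using that v by (auto simp: bag_def)
  have new: "bag ?H ?b n = {v}" using bag_range by (auto simp: bag_def)
  have v_bag: "v \<notin> bag G b y" for y using v by (simp add: bag_def)
  \<comment> \<open>A single vertex is the empty graph with a vertex attached to the empty clique,
    hence an \<open>m\<close>-tree for every \<open>m\<close>, including 0.\<close>
  have ind_new: "pair_induced ?H {v} = attach (pair_induced G {}) v {}"
    using graph.pair_induced_attach_insert[OF v CG, of "{}"] by simp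
  have kt_new: "k_tree m (pair_induced ?H {v})" for m
    unfolding ind_new
    by (intro k_tree.add_vertex k_tree_empty_induced) (auto simp: pair_induced_def clique_def)
  show ?thesis
  proof
    show "k_tree k ?H" by (fact kt)
    show "0 < Suc n" by simp
  next
    fix i assume "0 < i" "i < Suc n"
    then show "(par(n := x)) i < i" using par_less x(1) by (auto simp: less_Suc_eq)
  next
    fix w assume "w \<in> pverts ?H"
    then show "0 < ?b w \<and> ?b w < Suc n" using bag_range n_pos by (auto simp: less_Suc_eq)
  next
    fix u w assume "(u, w) \<in> parcs ?H"
    then consider "(u, w) \<in> parcs G" "u \<in> pverts G" "w \<in> pverts G"
      | "u = v" "w \<in> C" | "w = v" "u \<in> C"
      by (auto dest: graph.wellformed')
    then show "?b u = ?b w \<or> (par(n := x)) (?b u) = ?b w \<or> (par(n := x)) (?b w) = ?b u"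
    proof cases
      case 1
      then show ?thesis using bag_edge[of u w] bag_range[of u] bag_range[of w] v by auto
    qed (use x(2) v CG in \<open>auto simp: bag_def\<close>)
  next
    fix y assume y: "0 < y" "y < Suc n"
    show "clique ?H {u \<in> bag ?H ?b ((par(n := x)) y). \<exists>w\<in>bag ?H ?b y. (u, w) \<in> parcs ?H}"
    proof (cases "y = n")
      case True
      have "{u \<in> bag ?H ?b ((par(n := x)) y). \<exists>w\<in>bag ?H ?b y. (u, w) \<in> parcs ?H} \<subseteq> C"
        using True new old[OF x(1)] v_bag v by (auto dest: graph.wellformed')
      then show ?thesis by (rule clique_subset[OF clique_attach[OF C(1)]])
    next
      case False
      then have "y < n" "par y < n" using y par_less[of y] by auto
      then have "{u \<in> bag ?H ?b ((par(n := x)) y). \<exists>w\<in>bag ?H ?b y. (u, w) \<in> parcs ?H}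
          = {u \<in> bag G b (par y). \<exists>w\<in>bag G b y. (u, w) \<in> parcs G}"
        using False old v_bag by auto
      then show ?thesis using clique_attach[OF parent_clique[OF y(1) \<open>y < n\<close>]] by (simp only:)
    qed
  next
    fix y assume y: "y < Suc n"
    show "graph_connected (pair_induced ?H (bag ?H ?b y))"
    proof (cases "y = n")
      case True
      have "graph_connected (pair_induced ?H {v})"
        using kt_new[of 0] unfolding ind_new
        by (intro graph_connected_attach k_tree_imp_pair_graph[of 0] k_tree_empty_induced
            graph_connected_empty_induced) (auto simp: pair_induced_def)
      then show ?thesis using True new by simp
    qed (use y old bag_connected v_bag in \<open>simp add: pair_induced_attach_notin\<close>)
    show "k_tree (k - 1) (pair_induced ?H (bag ?H ?b y))"
      using y old new bag_k_tree kt_new v_bag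
      by (cases "y = n") (simp_all add: pair_induced_attach_notin)
    show "card (bag ?H ?b y) \<le> 1" if "k = 1"
      using y old new bag_singleton that by (cases "y = n") simp_all
  next
    fix y assume y: "0 < y" "y < Suc n" and "(par(n := x)) y = 0"
    then show "card (bag ?H ?b y) \<le> 1"
      using old new top_bag by (cases "y = n") simp_all
  next
    fix y w assume y: "0 < y" "y < Suc n" and px: "(par(n := x)) y \<noteq> 0"
      and w: "w \<in> bag ?H ?b y"
    show "\<exists>u\<in>bag ?H ?b ((par(n := x)) y). (u, w) \<in> parcs ?H"
    proof (cases "y = n")
      case True
      then have "C \<noteq> {}" using px x(3) by auto
      then show ?thesis using True w new old[OF x(1)] x(2) by auto
    next
      case False
      then have "y < n" "par y < n" using y par_less[of y] by auto
      then show ?thesis using False old px parent_neighbour[OF y(1) \<open>y < n\<close>, of w] w by auto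
    qed
  qed
qed

lemma extend_bag:
  assumes v: "v \<notin> pverts G" and C: "clique G C" "card C \<le> k"
    and x: "0 < x" "x < n" "C \<subseteq> bag G b x \<union> bag G b (par x)"
    and meets: "C \<inter> bag G b x \<noteq> {}" "C \<inter> bag G b (par x) \<noteq> {}"
  shows "bag_assignment n par k (attach G v C) (b(v := x))"
proof -
  let ?H = "attach G v C" and ?b = "b(v := x)"
  have kt: "k_tree k ?H" using k_tree v C by (rule k_tree.add_vertex)
  have CG: "C \<subseteq> pverts G" using C by (simp add: clique_def)
  then have finC: "finite C" using graph.pair_finite_verts finite_subset by blast
  have px: "par x < x" using par_less x by simp
  \<comment> \<open>The root bag is empty, so a node whose bag meets \<open>C\<close> is not the
    root.\<close>
  have px0: "par x \<noteq> 0" using meets(2) by auto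
  have old: "bag ?H ?b y = bag G b y" if "y \<noteq> x" for y
    using that v by (auto simp: bag_def)
  have new: "bag ?H ?b x = insert v (bag G b x)" by (auto simp: bag_def)
  have v_bag: "v \<notin> bag G b y" for y using v by (simp add: bag_def)
  have arcs_old: "(u, w) \<in> parcs ?H \<longleftrightarrow> (u, w) \<in> parcs G"
    if "u \<in> bag G b y" "w \<in> bag G b z" for u w y z
    using that v_bag by auto
  have ex_old: "(\<exists>w\<in>bag G b z. (u, w) \<in> parcs ?H) \<longleftrightarrow> (\<exists>w\<in>bag G b z. (u, w) \<in> parcs G)"
    if "u \<in> bag G b y" for u y z
    using arcs_old[OF that] by (intro bex_cong refl)
  have bex_insert: "(\<exists>w\<in>insert a S. P w) \<longleftrightarrow> P a \<or> (\<exists>w\<in>S. P w)" for a :: 'a and S P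
    by blast
  have arcs_v: "(u, v) \<in> parcs ?H \<longleftrightarrow> u \<in> C" if "u \<in> bag G b y" for u y
    using that v v_bag graph.in_arcsD2[of u v] by auto
  have disj: "bag G b x \<inter> bag G b (par x) = {}" using px by (auto simp: bag_def)
  \<comment> \<open>At least one vertex of \<open>C\<close> lies in \<open>par x\<close>, which
    leaves at most \<open>k - 1\<close> neighbours of \<open>v\<close> in its own bag.\<close>
  have "C \<inter> bag G b x \<subset> C" using meets(2) disj by blast
  then have "card (C \<inter> bag G b x) < card C" by (rule psubset_card_mono[OF finC])
  then have small: "card (C \<inter> bag G b x) \<le> k - 1" using C(2) by simp
  \<comment> \<open>As \<open>C\<close> meets \<open>x\<close> too, \<open>k - 1\<close> is
    positive; for \<open>k = 1\<close> bags never grow.\<close>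
  have "card (C \<inter> bag G b x) > 0" using meets(1) finC by (simp add: card_gt_0_iff)
  then have k: "k \<noteq> 1" using small by auto
  have ind: "pair_induced ?H (insert v (bag G b x))
      = attach (pair_induced G (bag G b x)) v (C \<inter> bag G b x)"
    by (rule graph.pair_induced_attach_insert[OF v CG])
  have kt_new: "k_tree (k - 1) (attach (pair_induced G (bag G b x)) v (C \<inter> bag G b x))"
    using bag_k_tree[OF x(2)] small v_bag
    by (intro k_tree.add_vertex clique_pair_induced clique_subset[OF C(1)])
      (auto simp: pair_induced_def)
  show ?thesis
  proof
    show "k_tree k ?H" by (fact kt)
  next
    fix w assume "w \<in> pverts ?H"
    then show "0 < ?b w \<and> ?b w < n" using bag_range x by auto
  next
    fix u w assume "(u, w) \<in> parcs ?H"
    then consider "(u, w) \<in> parcs G" "u \<in> pverts G" "w \<in> pverts G"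
      | "u = v" "w \<in> C" | "w = v" "u \<in> C"
      by (auto dest: graph.wellformed')
    then show "?b u = ?b w \<or> par (?b u) = ?b w \<or> par (?b w) = ?b u"
    proof cases
      case 1
      then show ?thesis using bag_edge[of u w] v by auto
    qed (use x(3) v CG in \<open>auto simp: bag_def\<close>)
  next
    fix y assume y: "0 < y" "y < n"
    have py: "par y < y" using par_less y by simp
    let ?N = "{u \<in> bag ?H ?b (par y). \<exists>w\<in>bag ?H ?b y. (u, w) \<in> parcs ?H}"
    \<comment> \<open>The parent clique of every node stays as it was. Only \<open>x\<close> itself
      and the children of \<open>x\<close> could be affected by \<open>v\<close>.\<close>
    have "?N = {u \<in> bag G b (par y). \<exists>w\<in>bag G b y. (u, w) \<in> parcs G}"
    proof (cases "y = x")
      case True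
      \<comment> \<open>Every vertex of \<open>C\<close> in \<open>par x\<close> is adjacent to
        \<open>c\<close>, so it belonged to the parent clique of \<open>x\<close> before
        \<open>v\<close> came.\<close>
      obtain c where c: "c \<in> C" "c \<in> bag G b x" using meets(1) by auto
      have "(u, c) \<in> parcs G" if u: "u \<in> C" "u \<in> bag G b (par x)" for u
      proof -
        have "u \<noteq> c" using c(2) u(2) disj by auto
        then show ?thesis using C(1) c(1) u(1) by (simp add: clique_def)
      qed
      then have absorb: "u \<in> C \<or> (\<exists>w\<in>bag G b x. (u, w) \<in> parcs G) \<longleftrightarrow>
          (\<exists>w\<in>bag G b x. (u, w) \<in> parcs G)"
        if "u \<in> bag G b (par x)" for u
        using that c(2) by blast
      have "(\<exists>w\<in>bag ?H ?b x. (u, w) \<in> parcs ?H) \<longleftrightarrow> (\<exists>w\<in>bag G b x. (u, w) \<in> parcs G)"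
        if u: "u \<in> bag G b (par x)" for u
        unfolding new bex_insert arcs_v[OF u] ex_old[OF u] by (rule absorb[OF u])
      moreover have "bag ?H ?b (par x) = bag G b (par x)" using px old by simp
      ultimately show ?thesis unfolding True by (simp only: cong: conj_cong)
    next
      case False
      show ?thesis
      proof (cases "par y = x")
        case True
        \<comment> \<open>A child \<open>y\<close> of \<open>x\<close> differs from both
          \<open>x\<close> and \<open>par x\<close>, whose bags contain \<open>C\<close>; hence
          \<open>v\<close> has no neighbour in the bag of \<open>y\<close>.\<close>
        have "w \<notin> C" if "w \<in> bag G b y" for w
          using that x(3) False True py px by (auto simp: bag_def)
        then have "\<not> (\<exists>w\<in>bag ?H ?b y. (v, w) \<in> parcs ?H)"
          using False old v_bag graph.in_arcsD1[of v] v by auto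
        then have "?N = {u \<in> bag G b x. \<exists>w\<in>bag ?H ?b y. (u, w) \<in> parcs ?H}"
          unfolding True new by blast
        then show ?thesis by (simp only: True old[OF False] ex_old cong: conj_cong)
      next
        case False
        then show ?thesis
          by (simp only: old[OF False] old[OF \<open>y \<noteq> x\<close>] ex_old cong: conj_cong)
      qed
    qed
    then show "clique ?H ?N" using clique_attach[OF parent_clique[OF y]] by (simp only:)
  next
    fix y assume y: "y < n"
    show "graph_connected (pair_induced ?H (bag ?H ?b y))"
    proof (cases "y = x")
      case True
      have "graph_connected (attach (pair_induced G (bag G b x)) v (C \<inter> bag G b x))"
        using bag_connected[OF x(2)] meets(1)
        by (intro graph_connected_attach k_tree_imp_pair_graph[OF kt_new]
            k_tree_imp_pair_graph[OF bag_k_tree[OF x(2)]]) (auto simp: pair_induced_def)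
      then show ?thesis using True new ind by simp
    qed (use y old bag_connected v_bag in \<open>simp add: pair_induced_attach_notin\<close>)
    show "k_tree (k - 1) (pair_induced ?H (bag ?H ?b y))"
      using y old new ind bag_k_tree kt_new v_bag
      by (cases "y = x") (simp_all add: pair_induced_attach_notin)
    show "card (bag ?H ?b y) \<le> 1" if "k = 1"
      using that k by simp
  next
    fix y assume y: "0 < y" "y < n" and "par y = 0"
    then show "card (bag ?H ?b y) \<le> 1"
      using old top_bag px0 by (cases "y = x") simp_all
  next
    fix y w assume y: "0 < y" "y < n" and py0: "par y \<noteq> 0" and w: "w \<in> bag ?H ?b y"
    have sub: "bag G b z \<subseteq> bag ?H ?b z" for z using v by (auto simp: bag_def)
    show "\<exists>u\<in>bag ?H ?b (par y). (u, w) \<in> parcs ?H"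
    proof (cases "w = v")
      case True
      then have "y = x" using w v_bag old[of y] by auto
      then show ?thesis using True meets(2) sub by auto
    next
      case False
      then have "w \<in> bag G b y" using w by (auto simp: bag_def)
      then obtain u where "u \<in> bag G b (par y)" "(u, w) \<in> parcs G"
        using parent_neighbour[OF y py0] by blast
      then show ?thesis using sub[of "par y"] by (intro bexI[of _ u]) auto
    qed
  qed
qed

end

text \<open>The induction carries more than (a) and (b): \<open>top_bag\<close>,
  \<open>parent_neighbour\<close> and \<open>bag_singleton\<close> are kept for the width
  bound.\<close>

lemma k_tree_bag_assignment:
  assumes "k_tree k G"
  shows "\<exists>n par b. bag_assignment n par k G b"
  using assms
proof (induction rule: k_tree.induct)
  case empty
  \<comment> \<open>The tree is the root alone; \<open>id\<close> and the constant map are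
    placeholders, as there are no other nodes and no vertices.\<close>
  have "bag_assignment 1 id k \<lparr>pverts = {}, parcs = {}\<rparr> (\<lambda>_. 0)"
    by unfold_locales
      (auto simp: bag_def k_tree.empty k_tree_empty_induced graph_connected_empty_induced)
  then show ?case by blast
next
  case (add_vertex G v C)
  then obtain n par b where "bag_assignment n par k G b" by blast
  then interpret bag_assignment n par k G b .
  note new = new_bag[OF add_vertex.hyps(2-4)]
  show ?case
  proof (cases "C = {}")
    case True
    then show ?thesis by (intro exI) (rule new[of 0], use n_pos in auto)
  next
    case False
    then obtain x where x: "0 < x" "x < n" "C \<subseteq> bag G b x \<union> bag G b (par x)"
        "C \<inter> bag G b x \<noteq> {}"
      using clique_in_two_bags add_vertex.hyps(3) by blast
    show ?thesis
    proof (cases "C \<inter> bag G b (par x) = {}")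
      case True
      then have "C \<subseteq> bag G b x" using x(3) by auto
      then show ?thesis by (intro exI) (rule new[OF x(2)], use False in auto)
    next
      case False
      then show ?thesis by (intro exI) (rule extend_bag[OF add_vertex.hyps(2-4) x])
    qed
  qed
qed

section \<open>The width\<close>

lemma (in pair_fin_digraph) card_neighbours_le_max_degree:
  assumes "u \<in> pverts G"
  shows "card {w. (u, w) \<in> parcs G} \<le> max_degree G"
proof -
  have "out_arcs (with_proj G) u = Pair u ` {w. (u, w) \<in> parcs G}"
    by (auto simp: out_arcs_def)
  moreover have "card (Pair u ` {w. (u, w) \<in> parcs G}) = card {w. (u, w) \<in> parcs G}"
    by (rule card_image) (simp add: inj_on_def)
  ultimately have "out_degree (with_proj G) u = card {w. (u, w) \<in> parcs G}"
    by (simp only: out_degree_def)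
  moreover have "out_degree (with_proj G) u \<le> max_degree G"
    unfolding max_degree_def using assms pair_finite_verts by (intro Max_ge) auto
  ultimately show ?thesis by (simp only:)
qed

context bag_assignment
begin

lemma finite_bag: "finite (bag G b x)"
  using graph.pair_finite_verts by (simp add: bag_def)

lemma finite_neighbours: "finite {w. (u, w) \<in> parcs G}"
  using graph.pair_finite_verts by (rule rev_finite_subset) (auto dest: graph.in_arcsD2)

text \<open>By \<open>parent_neighbour\<close> the neighbourhoods of the vertices of the parent
  clique cover the bag. The bound \<open>d\<close> will be the maximum degree if
  \<open>par x\<close> is a child of the root, and one less below that.\<close>

lemma card_bag_le_parent_clique:
  assumes x: "0 < x" "x < n" "par x \<noteq> 0"
    and deg: "\<And>u. u \<in> bag G b (par x) \<Longrightarrow> card ({w. (u, w) \<in> parcs G} \<inter> bag G b x) \<le> d"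
  shows "card (bag G b x)
    \<le> card {v \<in> bag G b (par x). \<exists>w\<in>bag G b x. (v, w) \<in> parcs G} * d"
proof -
  let ?N = "{v \<in> bag G b (par x). \<exists>w\<in>bag G b x. (v, w) \<in> parcs G}"
  have fin: "finite ?N" using finite_bag by simp
  have "bag G b x \<subseteq> (\<Union>u\<in>?N. {w. (u, w) \<in> parcs G} \<inter> bag G b x)"
    using parent_neighbour[OF x] by blast
  then have "card (bag G b x) \<le> card (\<Union>u\<in>?N. {w. (u, w) \<in> parcs G} \<inter> bag G b x)"
    by (intro card_mono) (use fin finite_bag in auto)
  also have "\<dots> \<le> (\<Sum>u\<in>?N. card ({w. (u, w) \<in> parcs G} \<inter> bag G b x))"
    by (rule card_UN_le[OF fin])
  also have "\<dots> \<le> card ?N * d" by (intro sum_bounded_above[THEN order_trans]) (auto intro: deg)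
  finally show ?thesis .
qed

lemma card_bag_le:
  assumes k: "1 \<le> k" and x: "x < n"
  shows "card (bag G b x) \<le> max 1 (k * (max_degree G - 1))"
proof (cases "x = 0 \<or> par x = 0 \<or> k = 1")
  case True
  then consider "x = 0" | "0 < x" "par x = 0" | "k = 1" by auto
  then have "card (bag G b x) \<le> 1" using top_bag bag_singleton x by cases auto
  then show ?thesis by simp
next
  case False
  then have x0: "0 < x" and px0: "par x \<noteq> 0" and k2: "2 \<le> k" using k by auto
  let ?y = "par x" and ?N = "{v \<in> bag G b (par x). \<exists>w\<in>bag G b x. (v, w) \<in> parcs G}"
  have y: "0 < ?y" "?y < n" using par_less[OF x0 x] x px0 by auto
  have deg: "card ({w. (u, w) \<in> parcs G} \<inter> bag G b x) \<le> max_degree G"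
    if "u \<in> bag G b ?y" for u
  proof -
    have "card ({w. (u, w) \<in> parcs G} \<inter> bag G b x) \<le> card {w. (u, w) \<in> parcs G}"
      by (intro card_mono finite_neighbours) auto
    also have "\<dots> \<le> max_degree G"
      using that by (intro graph.card_neighbours_le_max_degree) (auto simp: bag_def)
    finally show ?thesis .
  qed
  show ?thesis
  proof (cases "par ?y = 0")
    case True
    have "card ?N \<le> card (bag G b ?y)" by (intro card_mono finite_bag) auto
    also have "\<dots> \<le> 1" using top_bag[OF y True] .
    finally have "card ?N * max_degree G \<le> 1 * max_degree G" by (rule mult_right_mono) simp
    then have "card (bag G b x) \<le> max_degree G"
      using card_bag_le_parent_clique[OF x0 x px0 deg] by linarith
    \<comment> \<open>With truncated subtraction the second alternative holds from degree 2 on;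
      degrees 0 and 1 fall under the first.\<close>
    moreover have "max_degree G \<le> 1 \<or> max_degree G \<le> 2 * (max_degree G - 1)" by linarith
    moreover have "2 * (max_degree G - 1) \<le> k * (max_degree G - 1)"
      using k2 by (intro mult_right_mono) auto
    ultimately have "card (bag G b x) \<le> 1 \<or> card (bag G b x) \<le> k * (max_degree G - 1)"
      by linarith
    then show ?thesis unfolding le_max_iff_disj by blast
  next
    case False
    have "card ({w. (u, w) \<in> parcs G} \<inter> bag G b x) \<le> max_degree G - 1"
      if u: "u \<in> bag G b ?y" for u
    proof -
      \<comment> \<open>The neighbour \<open>z\<close> of \<open>u\<close> lies in the bag above
        \<open>par x\<close>, so one edge at \<open>u\<close> does not lead into the bag of
        \<open>x\<close>.\<close>
      obtain z where z: "z \<in> bag G b (par ?y)" "(z, u) \<in> parcs G"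
        using parent_neighbour[OF y False u] by blast
      have "par ?y \<noteq> x" using par_less[OF y] par_less[OF x0 x] by simp
      then have "z \<notin> bag G b x" using z(1) by (auto simp: bag_def)
      moreover have "(u, z) \<in> parcs G" using z(2) by (rule graph.arcs_symmetric)
      ultimately have "{w. (u, w) \<in> parcs G} \<inter> bag G b x \<subset> {w. (u, w) \<in> parcs G}" by auto
      then have "card ({w. (u, w) \<in> parcs G} \<inter> bag G b x) < card {w. (u, w) \<in> parcs G}"
        by (rule psubset_card_mono[OF finite_neighbours])
      also have "\<dots> \<le> max_degree G"
        using u by (intro graph.card_neighbours_le_max_degree) (auto simp: bag_def)
      finally show ?thesis by simp
    qed
    then have "card (bag G b x) \<le> card ?N * (max_degree G - 1)"
      by (rule card_bag_le_parent_clique[OF x0 x px0])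
    \<comment> \<open>The parent clique lies inside one bag, a \<open>(k - 1)\<close>-tree, which
      gives \<open>k\<close> where the \<open>k\<close>-tree \<open>G\<close> would only give
      \<open>k + 1\<close>.\<close>
    moreover have "card ?N \<le> Suc (k - 1)"
      using bag_k_tree[OF y(2)]
      by (rule k_tree_clique_card) (intro clique_pair_induced parent_clique[OF x0 x], auto)
    then have "card ?N * (max_degree G - 1) \<le> k * (max_degree G - 1)"
      using k by (intro mult_right_mono) auto
    ultimately have "card (bag G b x) \<le> k * (max_degree G - 1)" by (rule order_trans)
    then show ?thesis unfolding le_max_iff_disj by blast
  qed
qed

section \<open>Assembling the tree-partition\<close>

lemma tree_partition_bags: "tree_partition G (parent_tree n par) (bag G b)"
proof -
  have "(\<exists>x<n. v \<in> bag G b x \<and> w \<in> bag G b x) \<or>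
      (\<exists>(x, y)\<in>parcs (parent_tree n par). v \<in> bag G b x \<and> w \<in> bag G b y)"
    if vw: "(v, w) \<in> parcs G" for v w
  proof -
    have "v \<in> bag G b (b v)" "w \<in> bag G b (b w)" "0 < b v" "b v < n" "0 < b w" "b w < n"
      using graph.wellformed'[OF vw] bag_range by (auto simp: bag_def)
    moreover from this have "b v \<noteq> b w \<Longrightarrow> (b v, b w) \<in> parcs (parent_tree n par)"
      using bag_edge[OF vw] by (auto simp: in_parcs_parent_tree)
    ultimately show ?thesis by (cases "b v = b w") auto
  qed
  moreover have "(\<Union>x<n. bag G b x) = pverts G" using bag_range by (auto simp: bag_def)
  moreover have "disjoint_family_on (bag G b) {..<n}"
    by (auto simp: disjoint_family_on_def bag_def)
  ultimately show ?thesis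
    unfolding tree_partition_def using undirected_tree_parent_tree by (auto simp: Bex_def)
qed

end

theorem theorem6p1:
  fixes G :: "'a pair_pre_digraph" and k \<Delta> :: nat
  assumes "k \<ge> 1"
    and "k_tree k G"
    and "max_degree G = \<Delta>"
  shows "\<exists>(T :: nat pair_pre_digraph) r B.
    rooted_tree_partition G T r B \<and>
    (\<forall>x\<in>pverts T.
      (\<forall>y. x \<noteq> r \<and> is_parent T r y x \<longrightarrow>
         clique G {v \<in> B y. \<exists>w\<in>B x. (v, w) \<in> parcs G}) \<and>
      graph_connected (pair_induced G (B x)) \<and>
      k_tree (k - 1) (pair_induced G (B x))) \<and>
    int (tp_width T B) \<le> max 1 (int k * (int \<Delta> - 1))"
proof -
  obtain n par b where "bag_assignment n par k G b"
    using k_tree_bag_assignment[OF assms(2)] by blast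
  then interpret bag_assignment n par k G b .
  have "tp_width (parent_tree n par) (bag G b) \<le> max 1 (k * (\<Delta> - 1))"
    unfolding tp_width_def using n_pos card_bag_le assms(1,3) by (subst Max_le_iff) auto
  then have "int (tp_width (parent_tree n par) (bag G b)) \<le> max 1 (int (k * (\<Delta> - 1)))"
    by linarith
  \<comment> \<open>Truncated and integer subtraction differ only for degree 0, where the product is
    0 or \<open>-k\<close> and the maximum is 1 either way.\<close>
  also have "\<dots> \<le> max 1 (int k * (int \<Delta> - 1))"
    by (cases \<Delta>) auto
  finally have "int (tp_width (parent_tree n par) (bag G b)) \<le> max 1 (int k * (int \<Delta> - 1))" .
  moreover have "rooted_tree_partition G (parent_tree n par) 0 (bag G b)"
    using tree_partition_bags n_pos by (simp add: rooted_tree_partition_def)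
  moreover have "clique G {v \<in> bag G b y. \<exists>w\<in>bag G b x. (v, w) \<in> parcs G}"
    if "is_parent (parent_tree n par) 0 y x" for x y
    using is_parent_parent_tree[OF that] parent_clique by auto
  ultimately show ?thesis
    using bag_connected bag_k_tree
    by (intro exI[of _ "parent_tree n par"] exI[of _ 0] exI[of _ "bag G b"]) auto
qed

end
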